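(* Every measurable $\sigma$-modal algebra is isomorphic to a modal $\sigma$-field modulo a modal $\sigma$-ideal. That is, for every measurable $\sigma$-modal algebra $(B,\Diamond)$ there exist a Kripke frame $(X,R)$, a modal $\sigma$-field $\mathcal{F}$ on $(X,R)$ and a modal $\sigma$-ideal $I$ of the $\sigma$-modal algebra $(\mathcal{F},\Diamond_R)$ such that $(B,\Diamond)$ is isomorphic, as a $\sigma$-modal algebra, to the quotient $(\mathcal{F},\Diamond_R)/I$.
   Context: A $\sigma$-Boolean algebra is a Boolean algebra in which all countable joins and countable meets exist. A $\sigma$-modal algebra is a pair $(B,\Diamond)$ where $B$ is a $\sigma$-Boolean algebra and $\Diamond:B\to B$ satisfies $\Diamond\bot=\bot$ and $\Diamond\bigvee_{n\in\omega}b_n=\bigvee_{n\in\omega}\Diamond b_n$ for every sequence $(b_n)_{n\in\omega}$ in $B$. It is a measurable $\sigma$-modal algebra if moreover for every descending chain $b_0\ge b_1\ge b_2\ge\cdots$ in $B$, $\bigwedge_{n\in\omega}b_n=\bot$ implies $\bigwedge_{n\in\omega}\Diamond b_n=\bot$. An isomorphism of $\sigma$-modal algebras is a Boolean isomorphism commuting with the operators $\Diamond$ (it automatically preserves countable joins and meets). A Kripke frame is a set $X$ with a binary relation $R\subseteq X\times X$; write $R[x]=\{y\in X\mid xRy\}$ and, for $a\subseteq X$, $\Diamond_R a=\{x\in X\mid R[x]\cap a\neq\emptyset\}$. A modal $\sigma$-field on $(X,R)$ is a collection $\mathcal{F}$ of subsets of $X$ that contains $X$ and is closed under countable unions, complements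 and $\Diamond_R$; then $(\mathcal{F},\Diamond_R)$ is a $\sigma$-modal algebra with joins given by unions and meets by intersections. A $\sigma$-ideal of a $\sigma$-Boolean algebra $B$ is a nonempty subset $I\subseteq B$ that is downward closed and closed under countable joins. A modal $\sigma$-ideal of a $\sigma$-modal algebra $(B,\Diamond)$ is a $\sigma$-ideal $I$ of $B$ such that $b\in I$ implies $\Diamond b\in I$. Write $a\equiv_I b$ if $(a\wedge\neg b)\vee(b\wedge\neg a)\in I$, and $[b]$ for the class of $b$. The quotient $(B,\Diamond)/I$ is the set $B/I$ of classes with operations $\bot=[\bot]$, $\neg[b]=[\neg b]$, $\bigvee_{n\in\omega}[b_n]=[\bigvee_{n\in\omega}b_n]$ and $\Diamond^I[b]=[\Diamond b]$. *)

theory Defs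
  imports "HOL-Analysis.Sigma_Algebra" "HOL-Algebra.Congruence"
begin

text \<open>
  Modal algebras are given on a carrier set with explicit operations, so that an arbitrary
  algebra, an algebra of subsets and a quotient algebra are objects of the same kind. The fields
  \<open>Join\<close> and \<open>Meet\<close> name the countable joins and meets; in a
  \<open>\<sigma>\<close>-Boolean algebra they are required to be least upper and greatest lower bounds,
  which amounts to requiring that these bounds exist.
\<close>

record 'a modal_alg = "'a partial_object" +
  bt :: 'a ("\<bottom>\<index>")
  tp :: 'a ("\<top>\<index>")
  neg :: "'a \<Rightarrow> 'a" ("\<sim>\<index> _" [81] 80)
  meet :: "'a \<Rightarrow> 'a \<Rightarrow> 'a" (infixl "\<sqinter>\<index>" 70)
  join :: "'a \<Rightarrow> 'a \<Rightarrow> 'a" (infixl "\<squnion>\<index>" 65)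
  Meet :: "(nat \<Rightarrow> 'a) \<Rightarrow> 'a" ("\<Sqinter>\<index> _" [90] 90)
  Join :: "(nat \<Rightarrow> 'a) \<Rightarrow> 'a" ("\<Squnion>\<index> _" [90] 90)
  dia :: "'a \<Rightarrow> 'a" ("\<diamond>\<index> _" [81] 80)

definition ba_le :: "('a, 'm) modal_alg_scheme \<Rightarrow> 'a \<Rightarrow> 'a \<Rightarrow> bool" (infix "\<sqsubseteq>\<index>" 50) where
  "a \<sqsubseteq>\<^bsub>B\<^esub> b \<longleftrightarrow> a \<sqinter>\<^bsub>B\<^esub> b = a"

locale boolean_alg =
  fixes B :: "('a, 'm) modal_alg_scheme" (structure)
  assumes bot_closed: "\<bottom> \<in> carrier B"
    and top_closed: "\<top> \<in> carrier B"
    and neg_closed: "a \<in> carrier B \<Longrightarrow> \<sim> a \<in> carrier B"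
    and meet_closed: "a \<in> carrier B \<Longrightarrow> b \<in> carrier B \<Longrightarrow> a \<sqinter> b \<in> carrier B"
    and join_closed: "a \<in> carrier B \<Longrightarrow> b \<in> carrier B \<Longrightarrow> a \<squnion> b \<in> carrier B"
    and meet_comm: "a \<in> carrier B \<Longrightarrow> b \<in> carrier B \<Longrightarrow> a \<sqinter> b = b \<sqinter> a"
    and join_comm: "a \<in> carrier B \<Longrightarrow> b \<in> carrier B \<Longrightarrow> a \<squnion> b = b \<squnion> a"
    and meet_assoc: "a \<in> carrier B \<Longrightarrow> b \<in> carrier B \<Longrightarrow> c \<in> carrier B \<Longrightarrow>
          (a \<sqinter> b) \<sqinter> c = a \<sqinter> (b \<sqinter> c)"
    and join_assoc: "a \<in> carrier B \<Longrightarrow> b \<in> carrier B \<Longrightarrow> c \<in> carrier B \<Longrightarrow>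
          (a \<squnion> b) \<squnion> c = a \<squnion> (b \<squnion> c)"
    and meet_join_absorb: "a \<in> carrier B \<Longrightarrow> b \<in> carrier B \<Longrightarrow> a \<sqinter> (a \<squnion> b) = a"
    and join_meet_absorb: "a \<in> carrier B \<Longrightarrow> b \<in> carrier B \<Longrightarrow> a \<squnion> (a \<sqinter> b) = a"
    and meet_join_distrib: "a \<in> carrier B \<Longrightarrow> b \<in> carrier B \<Longrightarrow> c \<in> carrier B \<Longrightarrow>
          a \<sqinter> (b \<squnion> c) = (a \<sqinter> b) \<squnion> (a \<sqinter> c)"
    and join_bot: "a \<in> carrier B \<Longrightarrow> a \<squnion> \<bottom> = a"
    and meet_top: "a \<in> carrier B \<Longrightarrow> a \<sqinter> \<top> = a"
    and meet_neg: "a \<in> carrier B \<Longrightarrow> a \<sqinter> \<sim> a = \<bottom>"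
    and join_neg: "a \<in> carrier B \<Longrightarrow> a \<squnion> \<sim> a = \<top>"

locale sigma_boolean_alg = boolean_alg +
  assumes Join_closed: "(\<And>n. b n \<in> carrier B) \<Longrightarrow> \<Squnion> b \<in> carrier B"
    and Join_upper: "(\<And>n. b n \<in> carrier B) \<Longrightarrow> b n \<sqsubseteq> \<Squnion> b"
    and Join_least: "(\<And>n. b n \<in> carrier B) \<Longrightarrow> c \<in> carrier B \<Longrightarrow>
          (\<And>n. b n \<sqsubseteq> c) \<Longrightarrow> \<Squnion> b \<sqsubseteq> c"
    and Meet_closed: "(\<And>n. b n \<in> carrier B) \<Longrightarrow> \<Sqinter> b \<in> carrier B"
    and Meet_lower: "(\<And>n. b n \<in> carrier B) \<Longrightarrow> \<Sqinter> b \<sqsubseteq> b n"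
    and Meet_greatest: "(\<And>n. b n \<in> carrier B) \<Longrightarrow> c \<in> carrier B \<Longrightarrow>
          (\<And>n. c \<sqsubseteq> b n) \<Longrightarrow> c \<sqsubseteq> \<Sqinter> b"

locale sigma_modal_alg = sigma_boolean_alg +
  assumes dia_closed: "a \<in> carrier B \<Longrightarrow> \<diamond> a \<in> carrier B"
    and dia_bot: "\<diamond> \<bottom> = \<bottom>"
    and dia_Join: "(\<And>n. b n \<in> carrier B) \<Longrightarrow> \<diamond> (\<Squnion> b) = \<Squnion> (\<lambda>n. \<diamond> (b n))"

locale measurable_sigma_modal_alg = sigma_modal_alg +
  assumes dia_Meet_bot: "(\<And>n. b n \<in> carrier B) \<Longrightarrow> (\<And>n. b (Suc n) \<sqsubseteq> b n) \<Longrightarrow>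
          \<Sqinter> b = \<bottom> \<Longrightarrow> \<Sqinter> (\<lambda>n. \<diamond> (b n)) = \<bottom>"

definition sigma_modal_iso ::
    "('a, 'm) modal_alg_scheme \<Rightarrow> ('b, 'n) modal_alg_scheme \<Rightarrow> ('a \<Rightarrow> 'b) \<Rightarrow> bool" where
  "sigma_modal_iso A B h \<longleftrightarrow>
     sigma_modal_alg A \<and> sigma_modal_alg B \<and>
     bij_betw h (carrier A) (carrier B) \<and>
     h \<bottom>\<^bsub>A\<^esub> = \<bottom>\<^bsub>B\<^esub> \<and> h \<top>\<^bsub>A\<^esub> = \<top>\<^bsub>B\<^esub> \<and>
     (\<forall>a\<in>carrier A. h (\<sim>\<^bsub>A\<^esub> a) = \<sim>\<^bsub>B\<^esub> (h a)) \<and>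
     (\<forall>a\<in>carrier A. \<forall>b\<in>carrier A. h (a \<sqinter>\<^bsub>A\<^esub> b) = h a \<sqinter>\<^bsub>B\<^esub> h b) \<and>
     (\<forall>a\<in>carrier A. \<forall>b\<in>carrier A. h (a \<squnion>\<^bsub>A\<^esub> b) = h a \<squnion>\<^bsub>B\<^esub> h b) \<and>
     (\<forall>a\<in>carrier A. h (\<diamond>\<^bsub>A\<^esub> a) = \<diamond>\<^bsub>B\<^esub> (h a))"

definition sigma_modal_isomorphic ::
    "('a, 'm) modal_alg_scheme \<Rightarrow> ('b, 'n) modal_alg_scheme \<Rightarrow> bool" where
  "sigma_modal_isomorphic A B \<longleftrightarrow> (\<exists>h. sigma_modal_iso A B h)"

text \<open>The set of points of a Kripke frame may be empty.\<close>

definition kripke_frame :: "'x set \<Rightarrow> ('x \<times> 'x) set \<Rightarrow> bool" where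
  "kripke_frame X R \<longleftrightarrow> R \<subseteq> X \<times> X"

definition frame_dia :: "'x set \<Rightarrow> ('x \<times> 'x) set \<Rightarrow> 'x set \<Rightarrow> 'x set" where
  "frame_dia X R a = {x \<in> X. R `` {x} \<inter> a \<noteq> {}}"

definition modal_sigma_field :: "'x set \<Rightarrow> ('x \<times> 'x) set \<Rightarrow> 'x set set \<Rightarrow> bool" where
  "modal_sigma_field X R F \<longleftrightarrow> sigma_algebra X F \<and> (\<forall>a\<in>F. frame_dia X R a \<in> F)"

definition field_alg :: "'x set \<Rightarrow> ('x \<times> 'x) set \<Rightarrow> 'x set set \<Rightarrow> 'x set modal_alg" where
  "field_alg X R F =
     \<lparr>carrier = F, bt = {}, tp = X, neg = (\<lambda>a. X - a),
      meet = (\<inter>), join = (\<union>), Meet = (\<lambda>a. \<Inter>n. a n), Join = (\<lambda>a. \<Union>n. a n),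
      dia = frame_dia X R\<rparr>"

definition sigma_ideal :: "('a, 'm) modal_alg_scheme \<Rightarrow> 'a set \<Rightarrow> bool" where
  "sigma_ideal B I \<longleftrightarrow>
     I \<subseteq> carrier B \<and> I \<noteq> {} \<and>
     (\<forall>b\<in>I. \<forall>a\<in>carrier B. a \<sqsubseteq>\<^bsub>B\<^esub> b \<longrightarrow> a \<in> I) \<and>
     (\<forall>b. (\<forall>n. b n \<in> I) \<longrightarrow> \<Squnion>\<^bsub>B\<^esub> b \<in> I)"

definition modal_sigma_ideal :: "('a, 'm) modal_alg_scheme \<Rightarrow> 'a set \<Rightarrow> bool" where
  "modal_sigma_ideal B I \<longleftrightarrow> sigma_ideal B I \<and> (\<forall>b\<in>I. \<diamond>\<^bsub>B\<^esub> b \<in> I)"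

definition ideal_rel :: "('a, 'm) modal_alg_scheme \<Rightarrow> 'a set \<Rightarrow> ('a \<times> 'a) set" where
  "ideal_rel B I = {(a, b). a \<in> carrier B \<and> b \<in> carrier B \<and>
     (a \<sqinter>\<^bsub>B\<^esub> \<sim>\<^bsub>B\<^esub> b) \<squnion>\<^bsub>B\<^esub> (b \<sqinter>\<^bsub>B\<^esub> \<sim>\<^bsub>B\<^esub> a) \<in> I}"

definition ideal_class :: "('a, 'm) modal_alg_scheme \<Rightarrow> 'a set \<Rightarrow> 'a \<Rightarrow> 'a set" where
  "ideal_class B I a = ideal_rel B I `` {a}"

text \<open>
  Each operation on classes is the union, over all choices of representatives, of the class of
  the result. For a modal \<open>\<sigma>\<close>-ideal the result does not depend on the choice up to
  equivalence, so all the sets in such a union coincide.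
\<close>

definition quotient_alg ::
    "('a, 'm) modal_alg_scheme \<Rightarrow> 'a set \<Rightarrow> 'a set modal_alg" where
  "quotient_alg B I =
     \<lparr>carrier = carrier B // ideal_rel B I,
      bt = ideal_class B I \<bottom>\<^bsub>B\<^esub>,
      tp = ideal_class B I \<top>\<^bsub>B\<^esub>,
      neg = (\<lambda>c. \<Union>a\<in>c. ideal_class B I (\<sim>\<^bsub>B\<^esub> a)),
      meet = (\<lambda>c d. \<Union>a\<in>c. \<Union>b\<in>d. ideal_class B I (a \<sqinter>\<^bsub>B\<^esub> b)),
      join = (\<lambda>c d. \<Union>a\<in>c. \<Union>b\<in>d. ideal_class B I (a \<squnion>\<^bsub>B\<^esub> b)),
      Meet = (\<lambda>c. \<Union>b\<in>{b. \<forall>n. b n \<in> c n}. ideal_class B I (\<Sqinter>\<^bsub>B\<^esub> b)),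
      Join = (\<lambda>c. \<Union>b\<in>{b. \<forall>n. b n \<in> c n}. ideal_class B I (\<Squnion>\<^bsub>B\<^esub> b)),
      dia = (\<lambda>c. \<Union>a\<in>c. ideal_class B I (\<diamond>\<^bsub>B\<^esub> a))\<rparr>"

lemma sigma_modal_alg_field_alg:
  assumes F: "modal_sigma_field X R F"
  shows "sigma_modal_alg (field_alg X R F)"
proof -
  interpret sigma_algebra X F using F by (simp add: modal_sigma_field_def)
  have sub: "\<And>a. a \<in> F \<Longrightarrow> a \<subseteq> X" using sets_into_space by auto
  have d: "\<And>a. a \<in> F \<Longrightarrow> frame_dia X R a \<in> F" using F by (simp add: modal_sigma_field_def)
  have e: "frame_dia X R {} = {}" by (simp add: frame_dia_def)
  have j: "frame_dia X R (\<Union>n. b n) = (\<Union>n. frame_dia X R (b n))" for b :: "nat \<Rightarrow> 'a set"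
    unfolding frame_dia_def by blast
  show ?thesis
    by (rule sigma_modal_alg.intro; (rule sigma_boolean_alg.intro)?; (rule boolean_alg.intro)?;
        (rule sigma_boolean_alg_axioms.intro)?; (rule sigma_modal_alg_axioms.intro)?;
        simp add: field_alg_def ba_le_def e d j Int_absorb2 Un_absorb1 sub; blast?)
qed

end

theory Submission
  imports Defs "HOL-Library.Nat_Bijection"
begin

text \<open>
  The proof combines the Loomis--Sikorski theorem with the Jonsson--Tarski representation.
  The frame consists of the ultrafilters of \<open>B\<close>, where \<open>x\<close> sees \<open>y\<close> if \<open>b \<in> y\<close> implies \<open>\<diamond> b \<in> x\<close>.
  The Stone map \<open>s\<close> sends \<open>b\<close> to the set of ultrafilters that contain it. It preserves the finite
  Boolean operations and \<open>\<diamond>\<close>, but not countable meets: the difference between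
  \<open>\<Inter>n. s (b n)\<close> and \<open>s (\<Sqinter> b)\<close> is a set of the form \<open>\<Inter>n. s (d n)\<close> with \<open>d\<close> descending
  to \<open>\<bottom>\<close>. Call a set meagre if countably many sets of this form cover it.

  Let \<open>F\<close> consist of all sets that agree with some \<open>s b\<close> up to a meagre set. By the
  Rasiowa--Sikorski lemma, which is the Baire category theorem for the Stone space, \<open>s b\<close> is meagre
  only for \<open>b = \<bottom>\<close>. So \<open>b\<close> is determined by the set, and this gives a map from \<open>F\<close> onto \<open>B\<close>.
  Measurability enters at a single point: since
  \<open>\<diamond>\<^sub>R (\<Inter>n. s (d n)) \<subseteq> (\<Inter>n. s (\<diamond> (d n)))\<close> and \<open>\<diamond> (d n)\<close> again descends to \<open>\<bottom>\<close>, the operator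
  \<open>\<diamond>\<^sub>R\<close> maps meagre sets to meagre sets. Hence \<open>F\<close> is closed under \<open>\<diamond>\<^sub>R\<close> and the map to \<open>B\<close> commutes
  with it. It matters here that every subset of a meagre set is in \<open>F\<close>: if \<open>a\<close> agrees with \<open>s b\<close> up to
  a meagre set \<open>N\<close>, then \<open>\<diamond>\<^sub>R a\<close> differs from \<open>s (\<diamond> b)\<close> only inside \<open>\<diamond>\<^sub>R N\<close>, but nothing else is known
  about the difference, and in particular not that it lies in the \<open>\<sigma>\<close>-field generated by the sets
  \<open>s b\<close>.

  The map is therefore a surjective homomorphism of \<open>\<sigma>\<close>-modal algebras, and the theorem follows
  from the first isomorphism theorem, with the kernel as \<open>I\<close>.
\<close>

section \<open>Boolean algebras\<close>

context boolean_alg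
begin

lemma bot_join: "a \<in> carrier B \<Longrightarrow> \<bottom> \<squnion> a = a"
  using join_bot join_comm bot_closed by metis

lemma meet_bot: "a \<in> carrier B \<Longrightarrow> a \<sqinter> \<bottom> = \<bottom>"
  using meet_join_absorb[OF bot_closed, of a] bot_join meet_comm bot_closed by metis

lemma join_eq_bot:
  assumes "a \<in> carrier B" "b \<in> carrier B" "a \<squnion> b = \<bottom>"
  shows "a = \<bottom>" "b = \<bottom>"
  using assms meet_join_absorb meet_bot join_comm by metis+

lemma le_if_meet_neg_bot:
  assumes "a \<in> carrier B" "b \<in> carrier B" "a \<sqinter> \<sim> b = \<bottom>"
  shows "a \<sqsubseteq> b"
proof -
  have "a = a \<sqinter> (b \<squnion> \<sim> b)" using assms by (simp add: join_neg meet_top)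
  also have "\<dots> = a \<sqinter> b" using assms
    by (simp add: meet_join_distrib neg_closed join_bot meet_closed)
  finally show ?thesis by (simp add: ba_le_def)
qed

lemma le_antisym: "a \<in> carrier B \<Longrightarrow> b \<in> carrier B \<Longrightarrow> a \<sqsubseteq> b \<Longrightarrow> b \<sqsubseteq> a \<Longrightarrow> a = b"
  using meet_comm by (metis ba_le_def)

lemma le_refl: "a \<in> carrier B \<Longrightarrow> a \<sqsubseteq> a"
  using meet_join_absorb[of a "\<bottom>"] join_bot bot_closed by (simp add: ba_le_def)

lemma le_trans:
  "a \<in> carrier B \<Longrightarrow> b \<in> carrier B \<Longrightarrow> c \<in> carrier B \<Longrightarrow> a \<sqsubseteq> b \<Longrightarrow> b \<sqsubseteq> c \<Longrightarrow> a \<sqsubseteq> c"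
  unfolding ba_le_def by (metis meet_assoc)

lemma le_join1: "a \<in> carrier B \<Longrightarrow> b \<in> carrier B \<Longrightarrow> a \<sqsubseteq> a \<squnion> b"
  by (simp add: ba_le_def meet_join_absorb)

lemma le_join2: "a \<in> carrier B \<Longrightarrow> b \<in> carrier B \<Longrightarrow> b \<sqsubseteq> a \<squnion> b"
  using le_join1 join_comm by metis

lemma meet_le2: "a \<in> carrier B \<Longrightarrow> b \<in> carrier B \<Longrightarrow> a \<sqinter> b \<sqsubseteq> b"
  using le_refl by (simp add: ba_le_def meet_assoc)

lemma meet_le1: "a \<in> carrier B \<Longrightarrow> b \<in> carrier B \<Longrightarrow> a \<sqinter> b \<sqsubseteq> a"
  using meet_le2 meet_comm by metis

lemma join_least:
  assumes "a \<in> carrier B" "b \<in> carrier B" "c \<in> carrier B" "a \<sqsubseteq> c" "b \<sqsubseteq> c"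
  shows "a \<squnion> b \<sqsubseteq> c"
  using assms by (simp add: ba_le_def meet_comm[of "a \<squnion> b" c] meet_comm[of a c]
      meet_comm[of b c] meet_join_distrib join_closed)

lemma symdiff_bot_iff:
  assumes a: "a \<in> carrier B" and b: "b \<in> carrier B"
  shows "(a \<sqinter> \<sim> b) \<squnion> (b \<sqinter> \<sim> a) = \<bottom> \<longleftrightarrow> a = b"
proof
  assume "(a \<sqinter> \<sim> b) \<squnion> (b \<sqinter> \<sim> a) = \<bottom>"
  then have "a \<sqinter> \<sim> b = \<bottom>" "b \<sqinter> \<sim> a = \<bottom>"
    using join_eq_bot a b meet_closed neg_closed by metis+
  then show "a = b" using le_if_meet_neg_bot le_antisym a b by blast
next
  assume "a = b"
  then show "(a \<sqinter> \<sim> b) \<squnion> (b \<sqinter> \<sim> a) = \<bottom>" using b by (simp add: meet_neg join_bot bot_closed)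
qed

end

section \<open>Homomorphisms and the first isomorphism theorem\<close>

definition sigma_modal_hom ::
    "('a, 'm) modal_alg_scheme \<Rightarrow> ('b, 'n) modal_alg_scheme \<Rightarrow> ('a \<Rightarrow> 'b) \<Rightarrow> bool" where
  "sigma_modal_hom A B f \<longleftrightarrow>
     (\<forall>a\<in>carrier A. f a \<in> carrier B) \<and>
     f \<bottom>\<^bsub>A\<^esub> = \<bottom>\<^bsub>B\<^esub> \<and> f \<top>\<^bsub>A\<^esub> = \<top>\<^bsub>B\<^esub> \<and>
     (\<forall>a\<in>carrier A. f (\<sim>\<^bsub>A\<^esub> a) = \<sim>\<^bsub>B\<^esub> (f a)) \<and>
     (\<forall>a\<in>carrier A. \<forall>b\<in>carrier A. f (a \<sqinter>\<^bsub>A\<^esub> b) = f a \<sqinter>\<^bsub>B\<^esub> f b) \<and>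
     (\<forall>a\<in>carrier A. \<forall>b\<in>carrier A. f (a \<squnion>\<^bsub>A\<^esub> b) = f a \<squnion>\<^bsub>B\<^esub> f b) \<and>
     (\<forall>b. (\<forall>n. b n \<in> carrier A) \<longrightarrow> f (\<Sqinter>\<^bsub>A\<^esub> b) = \<Sqinter>\<^bsub>B\<^esub> (\<lambda>n. f (b n))) \<and>
     (\<forall>b. (\<forall>n. b n \<in> carrier A) \<longrightarrow> f (\<Squnion>\<^bsub>A\<^esub> b) = \<Squnion>\<^bsub>B\<^esub> (\<lambda>n. f (b n))) \<and>
     (\<forall>a\<in>carrier A. f (\<diamond>\<^bsub>A\<^esub> a) = \<diamond>\<^bsub>B\<^esub> (f a))"

lemma sigma_modal_homD:
  assumes "sigma_modal_hom A B f"
  shows "a \<in> carrier A \<Longrightarrow> f a \<in> carrier B"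
    and "f \<bottom>\<^bsub>A\<^esub> = \<bottom>\<^bsub>B\<^esub>" and "f \<top>\<^bsub>A\<^esub> = \<top>\<^bsub>B\<^esub>"
    and "a \<in> carrier A \<Longrightarrow> f (\<sim>\<^bsub>A\<^esub> a) = \<sim>\<^bsub>B\<^esub> (f a)"
    and "a \<in> carrier A \<Longrightarrow> b \<in> carrier A \<Longrightarrow> f (a \<sqinter>\<^bsub>A\<^esub> b) = f a \<sqinter>\<^bsub>B\<^esub> f b"
    and "a \<in> carrier A \<Longrightarrow> b \<in> carrier A \<Longrightarrow> f (a \<squnion>\<^bsub>A\<^esub> b) = f a \<squnion>\<^bsub>B\<^esub> f b"
    and "(\<And>n. u n \<in> carrier A) \<Longrightarrow> f (\<Sqinter>\<^bsub>A\<^esub> u) = \<Sqinter>\<^bsub>B\<^esub> (\<lambda>n. f (u n))"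
    and "(\<And>n. u n \<in> carrier A) \<Longrightarrow> f (\<Squnion>\<^bsub>A\<^esub> u) = \<Squnion>\<^bsub>B\<^esub> (\<lambda>n. f (u n))"
    and "a \<in> carrier A \<Longrightarrow> f (\<diamond>\<^bsub>A\<^esub> a) = \<diamond>\<^bsub>B\<^esub> (f a)"
  using assms by (simp_all add: sigma_modal_hom_def)

definition hom_kernel ::
    "('a, 'm) modal_alg_scheme \<Rightarrow> ('b, 'n) modal_alg_scheme \<Rightarrow> ('a \<Rightarrow> 'b) \<Rightarrow> 'a set" where
  "hom_kernel A B f = {a \<in> carrier A. f a = \<bottom>\<^bsub>B\<^esub>}"

lemma (in sigma_boolean_alg) Join_const_bot: "\<Squnion> (\<lambda>n. \<bottom>) = \<bottom>"
proof -
  have "\<Squnion> (\<lambda>n. \<bottom>) \<sqsubseteq> \<bottom>"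
    by (rule Join_least) (simp_all add: bot_closed ba_le_def meet_bot)
  then show ?thesis using Join_closed[of "\<lambda>n. \<bottom>"] by (simp add: ba_le_def meet_bot bot_closed)
qed

lemma modal_sigma_ideal_hom_kernel:
  assumes A: "sigma_modal_alg A" and B: "sigma_modal_alg B" and f: "sigma_modal_hom A B f"
  shows "modal_sigma_ideal A (hom_kernel A B f)"
proof -
  interpret A: sigma_modal_alg A by fact
  interpret B: sigma_modal_alg B by fact
  note f = sigma_modal_homD[OF f]
  have "a \<in> hom_kernel A B f"
    if "b \<in> hom_kernel A B f" "a \<in> carrier A" "a \<sqsubseteq>\<^bsub>A\<^esub> b" for a b
    using that f(5)[of a b] f(1)[of a] by (simp add: hom_kernel_def ba_le_def B.meet_bot)
  moreover have "\<exists>a. a \<in> carrier A \<and> f a = \<bottom>\<^bsub>B\<^esub>"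
    using f(2) A.bot_closed by blast
  ultimately show ?thesis
    using f(8,9)
    by (auto simp: modal_sigma_ideal_def sigma_ideal_def hom_kernel_def A.bot_closed A.Join_closed
        B.Join_const_bot A.dia_closed B.dia_bot)
qed

text \<open>
  The laws are equations and Horn clauses in the operations and the order, and the order is itself
  given by an equation, so each of them can be pulled back along the bijection.
\<close>

lemma sigma_modal_alg_transport:
  assumes B: "sigma_modal_alg B" and h: "sigma_modal_hom B Q h"
    and bij: "bij_betw h (carrier B) (carrier Q)"
  shows "sigma_modal_alg Q"
proof -
  interpret B: sigma_modal_alg B by fact
  define g where "g = inv_into (carrier B) h"
  have g: "g a \<in> carrier B" "h (g a) = a" if "a \<in> carrier Q" for a
    using that bij unfolding g_def bij_betw_def by (auto simp: inv_into_into f_inv_into_f)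
  note h = sigma_modal_homD[OF h]
  have eq: "h a = h b \<longleftrightarrow> a = b" if "a \<in> carrier B" "b \<in> carrier B" for a b
    using that bij by (auto simp: bij_betw_def inj_on_def)
  have le: "h a \<sqsubseteq>\<^bsub>Q\<^esub> h b \<longleftrightarrow> a \<sqsubseteq>\<^bsub>B\<^esub> b" if "a \<in> carrier B" "b \<in> carrier B" for a b
    using that by (simp add: ba_le_def h(5)[symmetric] eq B.meet_closed)
  have neg: "\<sim>\<^bsub>Q\<^esub> a = h (\<sim>\<^bsub>B\<^esub> (g a))" if "a \<in> carrier Q" for a
    using that by (simp add: h g)
  have meet: "a \<sqinter>\<^bsub>Q\<^esub> b = h (g a \<sqinter>\<^bsub>B\<^esub> g b)" if "a \<in> carrier Q" "b \<in> carrier Q" for a b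
    using that by (simp add: h g)
  have join: "a \<squnion>\<^bsub>Q\<^esub> b = h (g a \<squnion>\<^bsub>B\<^esub> g b)" if "a \<in> carrier Q" "b \<in> carrier Q" for a b
    using that by (simp add: h g)
  have dia: "\<diamond>\<^bsub>Q\<^esub> a = h (\<diamond>\<^bsub>B\<^esub> (g a))" if "a \<in> carrier Q" for a
    using that by (simp add: h g)
  have Meet: "\<Sqinter>\<^bsub>Q\<^esub> b = h (\<Sqinter>\<^bsub>B\<^esub> (\<lambda>n. g (b n)))" if "\<And>n. b n \<in> carrier Q" for b :: "nat \<Rightarrow> _"
    using that by (simp add: h g)
  have Join: "\<Squnion>\<^bsub>Q\<^esub> b = h (\<Squnion>\<^bsub>B\<^esub> (\<lambda>n. g (b n)))" if "\<And>n. b n \<in> carrier Q" for b :: "nat \<Rightarrow> _"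
    using that by (simp add: h g)
  have gh: "g (h a) = a" if "a \<in> carrier B" for a
    using that g[OF h(1)[OF that]] eq by blast
  have geq: "a = h b \<longleftrightarrow> g a = b" if "a \<in> carrier Q" "b \<in> carrier B" for a b
    using that g gh by auto
  have gle: "a \<sqsubseteq>\<^bsub>Q\<^esub> b \<longleftrightarrow> g a \<sqsubseteq>\<^bsub>B\<^esub> g b" if "a \<in> carrier Q" "b \<in> carrier Q" for a b
    using le[of "g a" "g b"] that by (simp add: g)
  note ops = neg meet join dia Meet Join h(2)[symmetric] h(3)[symmetric]
  note closed = B.bot_closed B.top_closed B.neg_closed B.meet_closed B.join_closed
    B.Join_closed B.Meet_closed B.dia_closed
  note [simp] = ops g gh gle geq eq h(1) closed
  have "boolean_alg Q"
    by unfold_locales (simp_all add: B.meet_assoc B.join_assoc B.meet_join_absorb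
        B.join_meet_absorb B.meet_join_distrib B.join_bot B.meet_top B.meet_neg B.join_neg,
      (simp add: B.meet_comm B.join_comm)+)
  moreover have "sigma_boolean_alg_axioms Q"
  proof
    fix b :: "nat \<Rightarrow> _" assume b: "\<And>n. b n \<in> carrier Q"
    show "\<Squnion>\<^bsub>Q\<^esub> b \<in> carrier Q" "\<Sqinter>\<^bsub>Q\<^esub> b \<in> carrier Q" using b by simp_all
    show "b n \<sqsubseteq>\<^bsub>Q\<^esub> \<Squnion>\<^bsub>Q\<^esub> b" for n
      using b B.Join_upper[of "\<lambda>n. g (b n)" n] by simp
    show "\<Sqinter>\<^bsub>Q\<^esub> b \<sqsubseteq>\<^bsub>Q\<^esub> b n" for n
      using b B.Meet_lower[of "\<lambda>n. g (b n)" n] by simp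
    fix c assume c: "c \<in> carrier Q"
    show "\<Squnion>\<^bsub>Q\<^esub> b \<sqsubseteq>\<^bsub>Q\<^esub> c" if "\<And>n. b n \<sqsubseteq>\<^bsub>Q\<^esub> c"
      using b c that B.Join_least[of "\<lambda>n. g (b n)" "g c"] by simp
    show "c \<sqsubseteq>\<^bsub>Q\<^esub> \<Sqinter>\<^bsub>Q\<^esub> b" if "\<And>n. c \<sqsubseteq>\<^bsub>Q\<^esub> b n"
      using b c that B.Meet_greatest[of "\<lambda>n. g (b n)" "g c"] by simp
  qed
  moreover have "sigma_modal_alg_axioms Q"
    by unfold_locales (simp_all add: B.dia_bot B.dia_Join)
  ultimately show ?thesis
    by (simp add: sigma_modal_alg_def sigma_boolean_alg_def)
qed

text \<open>
  The classes modulo the kernel are the fibres of \<open>f\<close>, so sending an element of \<open>B\<close> to its fibre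
  is the inverse of the map induced by \<open>f\<close>.
\<close>

lemma first_isomorphism_theorem:
  assumes A: "sigma_modal_alg A" and B: "sigma_modal_alg B" and hom: "sigma_modal_hom A B f"
    and surj: "f ` carrier A = carrier B"
  shows "sigma_modal_isomorphic B (quotient_alg A (hom_kernel A B f))"
proof -
  interpret A: sigma_modal_alg A by fact
  interpret B: sigma_modal_alg B by fact
  let ?I = "hom_kernel A B f" and ?Q = "quotient_alg A (hom_kernel A B f)"
  define h where "h b = {a \<in> carrier A. f a = b}" for b
  note f = sigma_modal_homD[OF hom]
  have rel: "ideal_rel A ?I = {(a, b). a \<in> carrier A \<and> b \<in> carrier A \<and> f a = f b}"
    by (auto simp: ideal_rel_def hom_kernel_def f A.meet_closed A.join_closed A.neg_closed
        B.symdiff_bot_iff)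
  have cls: "ideal_class A ?I a = h (f a)" if "a \<in> carrier A" for a
    using that by (auto simp: ideal_class_def rel h_def)
  have ne: "\<exists>a. a \<in> h b" if "b \<in> carrier B" for b
    using that unfolding surj[symmetric] by (auto simp: h_def)
  have bij: "bij_betw h (carrier B) (carrier ?Q)"
  proof -
    have "inj_on h (carrier B)"
      using ne by (fastforce simp: inj_on_def h_def)
    moreover have "carrier ?Q = (\<lambda>a. h (f a)) ` carrier A"
      using cls by (auto simp: quotient_alg_def quotient_def ideal_class_def)
    ultimately show ?thesis by (auto simp: bij_betw_def surj[symmetric])
  qed
  \<comment> \<open>An operation on classes is a union over representatives; all terms of the union coincide.\<close>
  have dep: "(\<Union>a\<in>S. G a) = K" if "\<exists>a. a \<in> S" "\<And>a. a \<in> S \<Longrightarrow> G a = K"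
    for S :: "'x set" and G and K :: "'y set"
    using that by auto
  have fib: "a \<in> carrier A \<and> f a = b" if "a \<in> h b" for a b
    using that by (simp add: h_def)
  have seq: "\<exists>a. a \<in> {a. \<forall>n. a n \<in> h (b n)}" if "\<And>n. b n \<in> carrier B" for b :: "nat \<Rightarrow> _"
    using choice[of "\<lambda>n a. a \<in> h (b n)"] ne that by auto
  have "sigma_modal_hom B ?Q h"
    unfolding sigma_modal_hom_def
  proof (intro conjI ballI allI impI)
    show "h b \<in> carrier ?Q" if "b \<in> carrier B" for b
      using that bij by (auto simp: bij_betw_def)
    show "h \<bottom>\<^bsub>B\<^esub> = \<bottom>\<^bsub>?Q\<^esub>" "h \<top>\<^bsub>B\<^esub> = \<top>\<^bsub>?Q\<^esub>"
      by (simp_all add: quotient_alg_def cls A.bot_closed A.top_closed f)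
    fix a assume a: "a \<in> carrier B"
    show "h (\<sim>\<^bsub>B\<^esub> a) = \<sim>\<^bsub>?Q\<^esub> (h a)"
      unfolding quotient_alg_def modal_alg.simps
      by (rule dep[symmetric], rule ne[OF a]) (drule fib, simp add: cls A.neg_closed f)
    show "h (\<diamond>\<^bsub>B\<^esub> a) = \<diamond>\<^bsub>?Q\<^esub> (h a)"
      unfolding quotient_alg_def modal_alg.simps
      by (rule dep[symmetric], rule ne[OF a]) (drule fib, simp add: cls A.dia_closed f)
    fix b assume b: "b \<in> carrier B"
    show "h (a \<sqinter>\<^bsub>B\<^esub> b) = h a \<sqinter>\<^bsub>?Q\<^esub> h b"
      unfolding quotient_alg_def modal_alg.simps
      by (rule dep[symmetric], rule ne[OF a], rule dep, rule ne[OF b])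
        ((drule fib)+, simp add: cls A.meet_closed f)
    show "h (a \<squnion>\<^bsub>B\<^esub> b) = h a \<squnion>\<^bsub>?Q\<^esub> h b"
      unfolding quotient_alg_def modal_alg.simps
      by (rule dep[symmetric], rule ne[OF a], rule dep, rule ne[OF b])
        ((drule fib)+, simp add: cls A.join_closed f)
  next
    fix b :: "nat \<Rightarrow> _" assume "\<forall>n. b n \<in> carrier B"
    then have b: "\<And>n. b n \<in> carrier B" by simp
    have fibs: "(\<forall>n. a n \<in> carrier A) \<and> (\<lambda>n. f (a n)) = b" if "\<forall>n. a n \<in> h (b n)" for a
      using that fib by auto
    show "h (\<Sqinter>\<^bsub>B\<^esub> b) = \<Sqinter>\<^bsub>?Q\<^esub> (\<lambda>n. h (b n))"
      unfolding quotient_alg_def modal_alg.simps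
      by (rule dep[symmetric], rule seq[OF b])
        (drule CollectD, drule fibs, simp add: cls A.Meet_closed f)
    show "h (\<Squnion>\<^bsub>B\<^esub> b) = \<Squnion>\<^bsub>?Q\<^esub> (\<lambda>n. h (b n))"
      unfolding quotient_alg_def modal_alg.simps
      by (rule dep[symmetric], rule seq[OF b])
        (drule CollectD, drule fibs, simp add: cls A.Join_closed f)
  qed
  then have "sigma_modal_iso B ?Q h"
    using bij sigma_modal_alg_transport[OF B _ bij] B
    by (simp add: sigma_modal_iso_def sigma_modal_hom_def)
  then show ?thesis by (auto simp: sigma_modal_isomorphic_def)
qed

section \<open>The Stone representation\<close>

context boolean_alg
begin

definition ultrafilters :: "'a set set" where
  "ultrafilters = {x. x \<subseteq> carrier B \<and>
     (\<forall>a\<in>carrier B. \<forall>b\<in>carrier B. a \<sqinter> b \<in> x \<longleftrightarrow> a \<in> x \<and> b \<in> x) \<and>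
     (\<forall>a\<in>carrier B. \<sim> a \<in> x \<longleftrightarrow> a \<notin> x)}"

definition stone :: "'a \<Rightarrow> 'a set set" where
  "stone b = {x \<in> ultrafilters. b \<in> x}"

definition ideal :: "'a set \<Rightarrow> bool" where
  "ideal J \<longleftrightarrow> J \<subseteq> carrier B \<and> \<bottom> \<in> J \<and>
     (\<forall>a\<in>carrier B. \<forall>b\<in>J. a \<sqsubseteq> b \<longrightarrow> a \<in> J) \<and> (\<forall>a\<in>J. \<forall>b\<in>J. a \<squnion> b \<in> J)"

lemma stone_subset: "stone b \<subseteq> ultrafilters"
  by (auto simp: stone_def)

lemma stone_meet:
  "a \<in> carrier B \<Longrightarrow> b \<in> carrier B \<Longrightarrow> stone (a \<sqinter> b) = stone a \<inter> stone b"
  by (auto simp: stone_def ultrafilters_def)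

lemma stone_neg: "a \<in> carrier B \<Longrightarrow> stone (\<sim> a) = ultrafilters - stone a"
  by (auto simp: stone_def ultrafilters_def)

lemma stone_bot: "stone \<bottom> = {}"
  using stone_meet[of \<bottom> "\<sim> \<bottom>"] stone_neg[of \<bottom>] meet_neg[of \<bottom>] bot_closed neg_closed by auto

lemma stone_top: "stone \<top> = ultrafilters"
proof -
  have "\<sim> \<bottom> = \<top>" using join_neg[OF bot_closed] bot_join neg_closed bot_closed by auto
  then show ?thesis using stone_neg[OF bot_closed] stone_bot by simp
qed

lemma stone_mono: "a \<in> carrier B \<Longrightarrow> b \<in> carrier B \<Longrightarrow> a \<sqsubseteq> b \<Longrightarrow> stone a \<subseteq> stone b"
  using stone_meet[of a b] by (auto simp: ba_le_def)

lemma stone_join: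
  assumes a: "a \<in> carrier B" and b: "b \<in> carrier B"
  shows "stone (a \<squnion> b) = stone a \<union> stone b"
proof
  have "a \<sqsubseteq> a \<squnion> b" "b \<sqsubseteq> a \<squnion> b"
    using meet_join_absorb a b join_comm by (metis ba_le_def)+
  then show "stone a \<union> stone b \<subseteq> stone (a \<squnion> b)"
    using stone_mono a b join_closed by simp
  have "\<sim> a \<sqinter> (a \<squnion> b) = \<sim> a \<sqinter> b"
    using a b by (simp add: meet_join_distrib neg_closed meet_comm[of "\<sim> a" a] meet_neg
        bot_join meet_closed)
  then have "(ultrafilters - stone a) \<inter> stone (a \<squnion> b) = (ultrafilters - stone a) \<inter> stone b"
    using a b by (metis stone_meet stone_neg neg_closed join_closed)
  then show "stone (a \<squnion> b) \<subseteq> stone a \<union> stone b"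
    using stone_subset by blast
qed

end

text \<open>
  A maximal ideal among those that contain \<open>J\<close> but not \<open>b\<close> is prime, and its complement is the
  required ultrafilter.
\<close>

lemma (in boolean_alg) ultrafilter_separation:
  assumes J: "ideal J" and b: "b \<in> carrier B" "b \<notin> J"
  obtains x where "x \<in> ultrafilters" "b \<in> x" "x \<inter> J = {}"
proof -
  define S where "S = {M. ideal M \<and> J \<subseteq> M \<and> b \<notin> M}"
  have "\<exists>M\<in>S. \<forall>N\<in>S. M \<subseteq> N \<longrightarrow> N = M"
  proof (rule subset_Zorn_nonempty)
    show "S \<noteq> {}" using J b by (auto simp: S_def)
    fix C assume ne: "C \<noteq> {}" and C: "subset.chain S C"
    have ids: "ideal M" "J \<subseteq> M" "b \<notin> M" if "M \<in> C" for M
      using C that by (auto simp: subset.chain_def S_def)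
    have "a \<squnion> c \<in> \<Union>C" if ac: "a \<in> \<Union>C" "c \<in> \<Union>C" for a c
    proof -
      obtain M N where MN: "M \<in> C" "N \<in> C" "a \<in> M" "c \<in> N" using ac by auto
      then have "M \<subseteq> N \<or> N \<subseteq> M" using C by (auto simp: subset_chain_def)
      then obtain P where "P \<in> C" "a \<in> P" "c \<in> P" using MN by auto
      moreover from this have "a \<squnion> c \<in> P" using ids(1)[of P] by (simp add: ideal_def)
      ultimately show ?thesis by blast
    qed
    moreover have "\<Union>C \<subseteq> carrier B" "\<bottom> \<in> \<Union>C" "J \<subseteq> \<Union>C"
      using ne ids(2) ids(1)[unfolded ideal_def] by blast+
    moreover have "a \<in> \<Union>C" if ac: "a \<in> carrier B" "c \<in> \<Union>C" "a \<sqsubseteq> c" for a c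
    proof -
      obtain M where M: "M \<in> C" "c \<in> M" using ac by auto
      then have "a \<in> M" using ids(1)[of M] ac unfolding ideal_def by blast
      then show ?thesis using M by blast
    qed
    ultimately have "ideal (\<Union>C)" "J \<subseteq> \<Union>C" unfolding ideal_def by blast+
    then show "\<Union>C \<in> S" using ids(3) by (auto simp: S_def)
  qed
  then obtain M where M: "ideal M" "J \<subseteq> M" "b \<notin> M"
    and max: "\<And>N. ideal N \<Longrightarrow> M \<subseteq> N \<Longrightarrow> b \<notin> N \<Longrightarrow> N = M"
    by (auto simp: S_def)
  have MB: "m \<in> carrier B" if "m \<in> M" for m using that M by (auto simp: ideal_def)
  have down: "a \<in> M" if "a \<in> carrier B" "m \<in> M" "a \<sqsubseteq> m" for a m
    using that M by (auto simp: ideal_def)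
  have Mj: "a \<squnion> c \<in> M" if "a \<in> M" "c \<in> M" for a c
    using that M by (auto simp: ideal_def)
  \<comment> \<open>By maximality, the ideal generated by \<open>M\<close> and an element outside \<open>M\<close> contains \<open>b\<close>.\<close>
  have ext: "\<exists>m\<in>M. b \<sqsubseteq> m \<squnion> a" if a: "a \<in> carrier B" "a \<notin> M" for a
  proof (rule ccontr)
    assume no: "\<not> (\<exists>m\<in>M. b \<sqsubseteq> m \<squnion> a)"
    define N where "N = {c \<in> carrier B. \<exists>m\<in>M. c \<sqsubseteq> m \<squnion> a}"
    have "ideal N"
      unfolding ideal_def
    proof (intro conjI ballI impI)
      show "N \<subseteq> carrier B" by (auto simp: N_def)
      show "\<bottom> \<in> N"
        using M(1) a bot_closed
        by (auto simp: N_def ideal_def ba_le_def meet_join_absorb intro!: bexI[of _ \<bottom>]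
            simp: bot_join meet_bot meet_comm[of \<bottom>])
      fix c d assume "d \<in> N"
      then obtain m where m: "m \<in> M" "d \<in> carrier B" "d \<sqsubseteq> m \<squnion> a" by (auto simp: N_def)
      {
        assume "c \<in> carrier B" "c \<sqsubseteq> d"
        then have "c \<sqsubseteq> m \<squnion> a"
          using le_trans m a MB join_closed by blast
        then show "c \<in> N" using \<open>c \<in> carrier B\<close> m by (auto simp: N_def)
      }
      assume "c \<in> N"
      then obtain k where k: "k \<in> M" "c \<in> carrier B" "c \<sqsubseteq> k \<squnion> a" by (auto simp: N_def)
      have mk: "m \<in> carrier B" "k \<in> carrier B" using m k MB by auto
      have "k \<squnion> a \<sqsubseteq> (k \<squnion> m) \<squnion> a" "m \<squnion> a \<sqsubseteq> (k \<squnion> m) \<squnion> a"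
      proof -
        have "k \<sqsubseteq> (k \<squnion> m) \<squnion> a" "m \<sqsubseteq> (k \<squnion> m) \<squnion> a"
          using le_trans[OF _ _ _ le_join1 le_join1] le_trans[OF _ _ _ le_join2 le_join1] mk a
          by (simp_all add: join_closed)
        then show "k \<squnion> a \<sqsubseteq> (k \<squnion> m) \<squnion> a" "m \<squnion> a \<sqsubseteq> (k \<squnion> m) \<squnion> a"
          using mk a by (simp_all add: join_least join_closed le_join2)
      qed
      then have "c \<sqsubseteq> (k \<squnion> m) \<squnion> a" "d \<sqsubseteq> (k \<squnion> m) \<squnion> a"
        using le_trans k m mk a join_closed by meson+
      then have "c \<squnion> d \<sqsubseteq> (k \<squnion> m) \<squnion> a"
        using join_least k m mk a join_closed by simp
      then show "c \<squnion> d \<in> N"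
        using Mj[OF k(1) m(1)] k m join_closed by (auto simp: N_def)
    qed
    moreover have "M \<subseteq> N"
      using MB a le_join1 by (auto simp: N_def)
    moreover have "b \<notin> N" using no by (auto simp: N_def)
    ultimately have "N = M" by (rule max)
    moreover have "a \<in> N"
      using M(1) a le_join2 bot_closed by (auto simp: N_def ideal_def)
    ultimately show False using a by simp
  qed
  have prime: "a \<in> M \<or> c \<in> M" if ac: "a \<in> carrier B" "c \<in> carrier B" "a \<sqinter> c \<in> M" for a c
  proof (rule ccontr)
    assume "\<not> (a \<in> M \<or> c \<in> M)"
    then obtain m k where mk: "m \<in> M" "k \<in> M" "b \<sqsubseteq> m \<squnion> a" "b \<sqsubseteq> k \<squnion> c"
      using ext ac by metis
    have mkB: "m \<in> carrier B" "k \<in> carrier B" using mk MB by auto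
    have e: "b \<sqinter> (m \<squnion> a) = b" "b \<sqinter> (k \<squnion> c) = b" using mk by (auto simp: ba_le_def)
    \<comment> \<open>Distributing \<open>b \<sqinter> (m \<squnion> a) \<sqinter> (k \<squnion> c)\<close>: every term lies below \<open>m\<close>, \<open>k\<close> or \<open>a \<sqinter> c\<close>.\<close>
    have "b \<sqinter> m \<in> M" using down[of "b \<sqinter> m" m] mk mkB b meet_le2 meet_closed by auto
    moreover have "(b \<sqinter> a) \<sqinter> k \<in> M"
      using down[of "(b \<sqinter> a) \<sqinter> k" k] mk mkB b ac meet_le2 meet_closed by auto
    moreover have "(b \<sqinter> a) \<sqinter> c \<in> M"
      using down[of "b \<sqinter> (a \<sqinter> c)" "a \<sqinter> c"] ac b meet_le2 meet_closed meet_assoc by auto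
    moreover have "b \<sqinter> a = (b \<sqinter> a) \<sqinter> (k \<squnion> c)"
    proof -
      have "b \<sqinter> a = (b \<sqinter> (k \<squnion> c)) \<sqinter> a" using e by simp
      also have "\<dots> = (b \<sqinter> a) \<sqinter> (k \<squnion> c)"
        using b ac mkB by (simp add: meet_assoc join_closed meet_comm[of "k \<squnion> c" a])
      finally show ?thesis .
    qed
    then have "b \<sqinter> a = ((b \<sqinter> a) \<sqinter> k) \<squnion> ((b \<sqinter> a) \<sqinter> c)"
      using meet_join_distrib b ac mkB meet_closed by simp
    moreover have "b = (b \<sqinter> m) \<squnion> (b \<sqinter> a)"
      using e(1) meet_join_distrib b ac mkB by simp
    ultimately have "b \<in> M" using Mj by metis
    then show False using M by simp
  qed
  have top: "\<top> \<notin> M"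
    using down[of b \<top>] b(1) M(3) by (auto simp: ba_le_def meet_top)
  have "carrier B - M \<in> ultrafilters"
    unfolding ultrafilters_def
  proof (intro CollectI conjI ballI)
    fix a assume a: "a \<in> carrier B"
    show "(\<sim> a \<in> carrier B - M) = (a \<notin> carrier B - M)"
      using prime[of a "\<sim> a"] Mj[of a "\<sim> a"] a top M(1)
      by (auto simp: meet_neg join_neg neg_closed ideal_def)
    fix c assume c: "c \<in> carrier B"
    show "(a \<sqinter> c \<in> carrier B - M) = (a \<in> carrier B - M \<and> c \<in> carrier B - M)"
      using prime[of a c] down[of "a \<sqinter> c" a] down[of "a \<sqinter> c" c] a c meet_le1 meet_le2
      by (auto simp: meet_closed)
  qed auto
  then show thesis using that[of "carrier B - M"] b M by blast
qed

context boolean_alg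
begin

lemma le_iff_stone:
  assumes a: "a \<in> carrier B" and b: "b \<in> carrier B"
  shows "a \<sqsubseteq> b \<longleftrightarrow> stone a \<subseteq> stone b"
proof
  assume sub: "stone a \<subseteq> stone b"
  show "a \<sqsubseteq> b"
  proof (rule ccontr)
    assume "\<not> a \<sqsubseteq> b"
    moreover have "ideal {c \<in> carrier B. c \<sqsubseteq> b}"
      unfolding ideal_def
    proof (intro conjI ballI impI)
      show "\<bottom> \<in> {c \<in> carrier B. c \<sqsubseteq> b}"
        using b bot_closed le_join1[of \<bottom> b] by (simp add: bot_join)
      show "c \<in> {c \<in> carrier B. c \<sqsubseteq> b}"
        if "c \<in> carrier B" "d \<in> {c \<in> carrier B. c \<sqsubseteq> b}" "c \<sqsubseteq> d" for c d
        using that b le_trans[of c d b] by simp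
      show "c \<squnion> d \<in> {c \<in> carrier B. c \<sqsubseteq> b}"
        if "c \<in> {c \<in> carrier B. c \<sqsubseteq> b}" "d \<in> {c \<in> carrier B. c \<sqsubseteq> b}" for c d
        using that b join_closed join_least[of c d b] by simp
    qed auto
    ultimately obtain x where "x \<in> ultrafilters" "a \<in> x" "x \<inter> {c \<in> carrier B. c \<sqsubseteq> b} = {}"
      using ultrafilter_separation[of "{c \<in> carrier B. c \<sqsubseteq> b}" a] a by blast
    moreover have "b \<sqsubseteq> b" using le_refl b .
    ultimately show False using sub b by (auto simp: stone_def)
  qed
qed (use assms stone_mono in blast)

lemma eq_iff_stone: "a \<in> carrier B \<Longrightarrow> b \<in> carrier B \<Longrightarrow> a = b \<longleftrightarrow> stone a = stone b"
  using le_iff_stone le_antisym by (metis order_refl)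

lemma eq_bot_iff_stone: "a \<in> carrier B \<Longrightarrow> a = \<bottom> \<longleftrightarrow> stone a = {}"
  using eq_iff_stone[of a \<bottom>] bot_closed stone_bot by simp

end

section \<open>Meagre sets and the Rasiowa--Sikorski lemma\<close>

context sigma_boolean_alg
begin

definition descends_to_bot :: "(nat \<Rightarrow> 'a) \<Rightarrow> bool" where
  "descends_to_bot d \<longleftrightarrow> (\<forall>n. d n \<in> carrier B \<and> d (Suc n) \<sqsubseteq> d n) \<and> \<Sqinter> d = \<bottom>"

text \<open>
  The sets \<open>\<Inter>n. stone (d k n)\<close> are closed nowhere dense sets of the Stone space. They are presented
  by descending sequences because the condition that makes a \<open>\<sigma>\<close>-modal algebra measurable speaks of
  such sequences.
\<close>

definition meagre :: "'a set set \<Rightarrow> bool" where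
  "meagre N \<longleftrightarrow> (\<exists>d :: nat \<Rightarrow> nat \<Rightarrow> 'a. (\<forall>k. descends_to_bot (d k)) \<and>
     N \<subseteq> (\<Union>k. \<Inter>n. stone (d k n)))"

lemma meagre_subset: "meagre N \<Longrightarrow> N' \<subseteq> N \<Longrightarrow> meagre N'"
  unfolding meagre_def by (meson subset_trans)

lemma meagre_UN:
  assumes "\<And>i :: nat. meagre (N i)"
  shows "meagre (\<Union>i. N i)"
proof -
  have "\<forall>i. \<exists>d. (\<forall>k. descends_to_bot (d k)) \<and> N i \<subseteq> (\<Union>k :: nat. \<Inter>n. stone (d k n))"
    using assms[unfolded meagre_def] by (rule allI)
  from choice[OF this] obtain d :: "nat \<Rightarrow> nat \<Rightarrow> nat \<Rightarrow> 'a"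
    where "\<forall>i. (\<forall>k. descends_to_bot (d i k)) \<and> N i \<subseteq> (\<Union>k :: nat. \<Inter>n. stone (d i k n))" ..
  then have d: "descends_to_bot (d i k)" "N i \<subseteq> (\<Union>k :: nat. \<Inter>n. stone (d i k n))" for i k
    by blast+
  let ?e = "\<lambda>j. case prod_decode j of (i, k) \<Rightarrow> d i k"
  have "(\<Union>i. N i) \<subseteq> (\<Union>j. \<Inter>n. stone (?e j n))"
  proof
    fix x assume "x \<in> (\<Union>i. N i)"
    then obtain i where "x \<in> N i" ..
    then have "x \<in> (\<Union>k :: nat. \<Inter>n. stone (d i k n))" using d(2) ..
    then obtain k where "x \<in> (\<Inter>n. stone (d i k n))" ..
    then have "x \<in> (\<Inter>n. stone (?e (prod_encode (i, k)) n))" by simp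
    then show "x \<in> (\<Union>j. \<Inter>n. stone (?e j n))" by (rule UN_I[OF UNIV_I])
  qed
  moreover have "descends_to_bot (?e j)" for j by (simp add: d(1) split: prod.split)
  ultimately show ?thesis unfolding meagre_def by (intro exI[of _ ?e] conjI allI)
qed

lemma meagre_INT_stone: "descends_to_bot d \<Longrightarrow> meagre (\<Inter>n. stone (d n))"
  unfolding meagre_def by (intro exI[of _ "\<lambda>k. d"]) auto

lemma meagre_empty: "meagre {}"
proof -
  have "\<Sqinter> (\<lambda>n. \<bottom>) = \<bottom>"
    using Meet_lower[of "\<lambda>n. \<bottom>"] Meet_closed[of "\<lambda>n. \<bottom>"] bot_closed
    by (simp add: ba_le_def meet_bot)
  then have "descends_to_bot (\<lambda>n. \<bottom>)"
    using bot_closed by (simp add: descends_to_bot_def le_refl)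
  then show ?thesis using meagre_INT_stone meagre_subset by blast
qed

lemma meagre_Un:
  assumes "meagre M" "meagre N"
  shows "meagre (M \<union> N)"
proof -
  have "meagre (\<Union>i :: nat. if i = 0 then M else N)" using assms by (intro meagre_UN) auto
  moreover have "M \<union> N \<subseteq> (\<Union>i :: nat. if i = 0 then M else N)" by (auto split: if_splits)
  ultimately show ?thesis by (rule meagre_subset)
qed

text \<open>
  A nonzero \<open>b\<close> is refined step by step so that the \<open>k\<close>-th step leaves the \<open>k\<close>-th of the countably
  many covering sets. The refinements stay nonzero, so some ultrafilter contains all of them.
\<close>

lemma rasiowa_sikorski:
  assumes b: "b \<in> carrier B" and meagre: "meagre (stone b)"
  shows "b = \<bottom>"
proof (rule ccontr)
  assume "b \<noteq> \<bottom>"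
  obtain d :: "nat \<Rightarrow> nat \<Rightarrow> 'a" where desc_d: "\<And>k. descends_to_bot (d k)"
    and cover: "stone b \<subseteq> (\<Union>k. \<Inter>n. stone (d k n))"
    using meagre unfolding meagre_def by auto
  have d: "d k n \<in> carrier B" "\<Sqinter> (d k) = \<bottom>" for k n
    using desc_d[of k] by (simp_all add: descends_to_bot_def)
  have step: "\<exists>c'. (c' \<in> carrier B \<and> c' \<noteq> \<bottom>) \<and> stone c' \<subseteq> stone c \<and>
      (\<exists>n. stone c' \<inter> stone (d k n) = {})"
    if c: "c \<in> carrier B \<and> c \<noteq> \<bottom>" for c k
  proof -
    have "\<exists>n. c \<sqinter> \<sim> (d k n) \<noteq> \<bottom>"
    proof (rule ccontr)
      assume "\<nexists>n. c \<sqinter> \<sim> (d k n) \<noteq> \<bottom>"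
      then have "\<And>n. c \<sqsubseteq> d k n" using le_if_meet_neg_bot c d(1) by blast
      then have "c \<sqsubseteq> \<bottom>" using Meet_greatest[of "d k" c] c d by simp
      then show False using c by (simp add: ba_le_def meet_bot)
    qed
    then obtain n where "c \<sqinter> \<sim> (d k n) \<noteq> \<bottom>" by blast
    then show ?thesis using c d(1)
      by (intro exI[of _ "c \<sqinter> \<sim> (d k n)"])
        (auto simp: meet_closed neg_closed stone_meet stone_neg)
  qed
  have "\<exists>c. \<forall>k. ((c k \<in> carrier B \<and> c k \<noteq> \<bottom>) \<and> (k = 0 \<longrightarrow> c k = b)) \<and>
      (stone (c (Suc k)) \<subseteq> stone (c k) \<and> (\<exists>n. stone (c (Suc k)) \<inter> stone (d k n) = {}))"
    by (rule dependent_nat_choice) (use step b \<open>b \<noteq> \<bottom>\<close> in auto)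
  then obtain c where "\<forall>k. ((c k \<in> carrier B \<and> c k \<noteq> \<bottom>) \<and> (k = 0 \<longrightarrow> c k = b)) \<and>
      (stone (c (Suc k)) \<subseteq> stone (c k) \<and> (\<exists>n. stone (c (Suc k)) \<inter> stone (d k n) = {}))" ..
  then have c0: "c 0 = b" and c: "\<And>k. c k \<in> carrier B \<and> c k \<noteq> \<bottom>"
    and desc: "\<And>k. stone (c (Suc k)) \<subseteq> stone (c k)"
    and avoid: "\<And>k. \<exists>n. stone (c (Suc k)) \<inter> stone (d k n) = {}"
    by simp_all
  have mono: "stone (c m) \<subseteq> stone (c k)" if "k \<le> m" for k m
    using that desc by (rule lift_Suc_antimono_le[rotated])
  let ?J = "{a \<in> carrier B. \<exists>k. stone a \<inter> stone (c k) = {}}"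
  \<comment> \<open>An ultrafilter that misses \<open>?J\<close> contains every \<open>c k\<close>, because \<open>\<sim> (c k)\<close> is in \<open>?J\<close>.\<close>
  have idJ: "ideal ?J"
    unfolding ideal_def
  proof (intro conjI ballI impI)
    show "\<bottom> \<in> ?J" by (simp add: bot_closed stone_bot)
    fix a a' assume a': "a' \<in> ?J"
    { assume "a \<in> carrier B" "a \<sqsubseteq> a'"
      then show "a \<in> ?J" using a' stone_mono[of a a'] by blast }
    assume "a \<in> ?J"
    then obtain k k' where "stone a \<inter> stone (c k) = {}" "stone a' \<inter> stone (c k') = {}"
      using a' by blast
    then have "(stone a \<union> stone a') \<inter> stone (c (max k k')) = {}"
      using mono[of k "max k k'"] mono[of k' "max k k'"] by auto
    then show "a \<squnion> a' \<in> ?J"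
      using \<open>a \<in> ?J\<close> a' by (auto simp: join_closed stone_join)
  qed auto
  have topJ: "\<top> \<notin> ?J"
  proof
    assume "\<top> \<in> ?J"
    then obtain k where "ultrafilters \<inter> stone (c k) = {}" by (auto simp: stone_top)
    then show False using c[of k] eq_bot_iff_stone[of "c k"] stone_subset[of "c k"] by blast
  qed
  obtain x where x: "x \<in> ultrafilters" "\<top> \<in> x" "x \<inter> ?J = {}"
    by (rule ultrafilter_separation[OF idJ top_closed topJ])
  have xc: "x \<in> stone (c k)" for k
  proof -
    have "stone (\<sim> (c k)) \<inter> stone (c k) = {}" using c[of k] by (auto simp: stone_neg)
    then have "\<sim> (c k) \<in> ?J" using c[of k] by (auto intro: neg_closed)
    then have "\<sim> (c k) \<notin> x" using x(3) by blast
    then show ?thesis using c[of k] x(1) stone_neg[of "c k"] by (auto simp: stone_def)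
  qed
  then have "x \<in> stone b" using c0 by metis
  then have "x \<in> (\<Union>k. \<Inter>n. stone (d k n))" using cover ..
  then obtain k where "x \<in> (\<Inter>n. stone (d k n))" ..
  then show False using avoid[of k] xc[of "Suc k"] by blast
qed

primrec partial_meet :: "(nat \<Rightarrow> 'a) \<Rightarrow> nat \<Rightarrow> 'a" where
  "partial_meet b 0 = b 0"
| "partial_meet b (Suc n) = partial_meet b n \<sqinter> b (Suc n)"

lemma partial_meet:
  assumes "\<And>n. b n \<in> carrier B"
  shows "partial_meet b n \<in> carrier B \<and> stone (partial_meet b n) = (\<Inter>i\<le>n. stone (b i))"
  by (induction n) (auto simp: assms meet_closed stone_meet atMost_Suc)

lemma stone_Meet_subset:
  "(\<And>n. b n \<in> carrier B) \<Longrightarrow> stone (\<Sqinter> b) \<subseteq> (\<Inter>n. stone (b n))"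
  by (intro INT_greatest stone_mono Meet_closed Meet_lower)

text \<open>
  The set consists of the ultrafilters that contain every \<open>b n\<close> and \<open>\<sim> (\<Sqinter> b)\<close>. Replacing \<open>b n\<close> by
  \<open>b 0 \<sqinter> \<dots> \<sqinter> b n\<close> makes the sequence \<open>\<sim> (\<Sqinter> b) \<sqinter> b n\<close> descending, and its meet is \<open>\<bottom>\<close>.
\<close>

lemma meagre_Meet_defect:
  assumes b: "\<And>n. b n \<in> carrier B"
  shows "meagre ((\<Inter>n. stone (b n)) - stone (\<Sqinter> b))"
proof -
  define d where "d n = \<sim> (\<Sqinter> b) \<sqinter> partial_meet b n" for n
  have d: "d n \<in> carrier B" "stone (d n) = (\<Inter>i\<le>n. stone (b i)) - stone (\<Sqinter> b)" for n
    using partial_meet[of b n, OF b] Meet_closed[of b, OF b] stone_subset[of "b 0"]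
    by (auto simp: d_def meet_closed neg_closed stone_meet stone_neg)
  have M: "\<Sqinter> d \<in> carrier B" "stone (\<Sqinter> d) \<subseteq> (\<Inter>n. stone (d n))"
    using Meet_closed[of d] stone_Meet_subset[of d] d(1) by auto
  then have "\<Sqinter> d \<sqsubseteq> b n" for n
    using le_iff_stone[of "\<Sqinter> d" "b n"] b d(2) by blast
  then have "\<Sqinter> d \<sqsubseteq> \<Sqinter> b" using Meet_greatest[of b, OF b] M(1) by blast
  then have "stone (\<Sqinter> d) = {}"
    using stone_mono[OF M(1) Meet_closed[of b, OF b]] M(2) d(2) by blast
  then have "\<Sqinter> d = \<bottom>" using eq_bot_iff_stone M(1) by blast
  moreover have "d (Suc n) \<sqsubseteq> d n" for n
    using le_iff_stone d by auto
  ultimately have "descends_to_bot d" using d(1) by (simp add: descends_to_bot_def)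
  then have "meagre (\<Inter>n. stone (d n))" by (rule meagre_INT_stone)
  then show ?thesis by (rule meagre_subset) (auto simp: d)
qed

lemma neg_Meet_neg:
  assumes b: "\<And>n. b n \<in> carrier B"
  shows "\<sim> (\<Sqinter> (\<lambda>n. \<sim> (b n))) = \<Squnion> b"
proof -
  let ?m = "\<Sqinter> (\<lambda>n. \<sim> (b n))"
  have n: "\<sim> (b n) \<in> carrier B" for n using b by (rule neg_closed)
  note mc = Meet_closed[of "\<lambda>n. \<sim> (b n)", OF n]
  have jc: "\<Squnion> b \<in> carrier B" using b by (rule Join_closed)
  have "b n \<sqsubseteq> \<sim> ?m" for n
  proof -
    have "stone ?m \<subseteq> stone (\<sim> (b n))" by (intro stone_mono Meet_lower mc n)
    then show ?thesis
      using b stone_subset[of "b n"] by (auto simp: le_iff_stone mc neg_closed stone_neg)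
  qed
  then have 1: "\<Squnion> b \<sqsubseteq> \<sim> ?m" by (intro Join_least b neg_closed mc)
  have "\<sim> (\<Squnion> b) \<sqsubseteq> \<sim> (b n)" for n
    using stone_mono[of "b n" "\<Squnion> b"] Join_upper[of b n] b jc
    by (auto simp: le_iff_stone neg_closed stone_neg)
  then have "\<sim> (\<Squnion> b) \<sqsubseteq> ?m" by (intro Meet_greatest n neg_closed jc)
  then have 2: "\<sim> ?m \<sqsubseteq> \<Squnion> b"
    by (auto simp: le_iff_stone mc jc neg_closed stone_neg)
  show ?thesis using neg_closed[OF mc] jc 2 1 by (rule le_antisym)
qed

section \<open>Sets represented by elements of the algebra\<close>

definition represents :: "'a \<Rightarrow> 'a set set \<Rightarrow> bool" where
  "represents b a \<longleftrightarrow> b \<in> carrier B \<and> a \<subseteq> ultrafilters \<and>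
     meagre (sym_diff a (stone b))"

text \<open>
  Modulo meagre sets these are the sets \<open>stone b\<close>, as the sets with the Baire property are the open
  sets modulo meagre sets.
\<close>

definition almost_stone :: "'a set set set" where
  "almost_stone = {a. \<exists>b. represents b a}"

definition represented :: "'a set set \<Rightarrow> 'a" where
  "represented a = (THE b. represents b a)"

lemma representsI:
  assumes "b \<in> carrier B" "a \<subseteq> ultrafilters" "meagre N" "sym_diff a (stone b) \<subseteq> N"
  shows "represents b a"
  using assms meagre_subset by (simp add: represents_def)

lemma representsD:
  assumes "represents b a"
  shows "b \<in> carrier B" "a \<subseteq> ultrafilters" "meagre (sym_diff a (stone b))"
  using assms by (simp_all add: represents_def)

lemma represents_stone: "b \<in> carrier B \<Longrightarrow> represents b (stone b)"
  by (simp add: represents_def stone_subset meagre_empty)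

text \<open>
  If \<open>a\<close> is close to both \<open>stone b\<close> and \<open>stone c\<close>, then \<open>stone (b \<sqinter> \<sim> c)\<close> is meagre, so that
  \<open>b \<sqinter> \<sim> c = \<bottom>\<close> by the Rasiowa--Sikorski lemma.
\<close>

lemma represents_unique:
  assumes "represents b a" "represents c a"
  shows "b = c"
proof -
  have le: "b \<sqsubseteq> c" if "represents b a" "represents c a" for b c
  proof -
    have bc: "b \<in> carrier B" "c \<in> carrier B" using that by (auto simp: represents_def)
    have "meagre (sym_diff a (stone b) \<union> sym_diff a (stone c))"
      using that by (intro meagre_Un representsD)
    then have "meagre (stone (b \<sqinter> \<sim> c))"
      by (rule meagre_subset) (auto simp: bc neg_closed stone_meet stone_neg)
    then show ?thesis
      by (intro le_if_meet_neg_bot rasiowa_sikorski meet_closed neg_closed bc)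
  qed
  from le_antisym[OF _ _ le[OF assms] le[OF assms(2,1)]] show ?thesis
    using assms by (simp add: represents_def)
qed

lemma represented_eqI: "represents b a \<Longrightarrow> represented a = b"
  unfolding represented_def by (rule the_equality) (auto intro: represents_unique)

lemma represents_represented: "a \<in> almost_stone \<Longrightarrow> represents (represented a) a"
proof -
  assume "a \<in> almost_stone"
  then obtain b where "represents b a" by (auto simp: almost_stone_def)
  then show ?thesis by (simp add: represented_eqI[of b a])
qed

lemma represents_neg:
  assumes "represents b a"
  shows "represents (\<sim> b) (ultrafilters - a)"
proof (rule representsI)
  note r = representsD[OF assms]
  show "meagre (sym_diff a (stone b))" by (rule r)
  show "sym_diff (ultrafilters - a) (stone (\<sim> b)) \<subseteq> sym_diff a (stone b)"
    using r stone_subset[of b] by (auto simp: stone_neg)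
qed (use assms in \<open>auto simp: represents_def neg_closed\<close>)

lemma represents_meet:
  assumes "represents b a" "represents c d"
  shows "represents (b \<sqinter> c) (a \<inter> d)"
proof (rule representsI)
  note r = representsD[OF assms(1)] representsD[OF assms(2)]
  show "meagre (sym_diff a (stone b) \<union> sym_diff d (stone c))" by (intro meagre_Un r)
  show "sym_diff (a \<inter> d) (stone (b \<sqinter> c)) \<subseteq> sym_diff a (stone b) \<union> sym_diff d (stone c)"
    using r by (auto simp: stone_meet)
qed (use assms in \<open>auto simp: represents_def meet_closed\<close>)

lemma represents_join:
  assumes "represents b a" "represents c d"
  shows "represents (b \<squnion> c) (a \<union> d)"
proof (rule representsI)
  note r = representsD[OF assms(1)] representsD[OF assms(2)]
  show "meagre (sym_diff a (stone b) \<union> sym_diff d (stone c))" by (intro meagre_Un r)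
  show "sym_diff (a \<union> d) (stone (b \<squnion> c)) \<subseteq> sym_diff a (stone b) \<union> sym_diff d (stone c)"
    using r by (auto simp: stone_join)
qed (use assms in \<open>auto simp: represents_def join_closed\<close>)

lemma represents_Meet:
  assumes "\<And>n. represents (b n) (a n)"
  shows "represents (\<Sqinter> b) (\<Inter>n. a n)"
proof (rule representsI)
  note r = representsD[OF assms]
  let ?N = "(\<Union>n. sym_diff (a n) (stone (b n))) \<union> ((\<Inter>n. stone (b n)) - stone (\<Sqinter> b))"
  show "\<Sqinter> b \<in> carrier B" using r(1) by (rule Meet_closed)
  show "(\<Inter>n. a n) \<subseteq> ultrafilters" using r(2)[of 0] by auto
  show "meagre ?N" by (intro meagre_Un meagre_UN meagre_Meet_defect r)
  show "sym_diff (\<Inter>n. a n) (stone (\<Sqinter> b)) \<subseteq> ?N"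
    using stone_Meet_subset[of b, OF r(1)] by auto
qed

lemma represents_Join:
  assumes r: "\<And>n. represents (b n) (a n)"
  shows "represents (\<Squnion> b) (\<Union>n. a n)"
proof -
  have "represents (\<sim> (\<Sqinter> (\<lambda>n. \<sim> (b n)))) (ultrafilters - (\<Inter>n. ultrafilters - a n))"
    by (intro represents_neg represents_Meet r)
  moreover have "ultrafilters - (\<Inter>n. ultrafilters - a n) = (\<Union>n. a n)"
    using r by (auto simp: represents_def)
  moreover have "\<sim> (\<Sqinter> (\<lambda>n. \<sim> (b n))) = \<Squnion> b"
    using r by (intro neg_Meet_neg) (simp add: represents_def)
  ultimately show ?thesis by simp
qed

lemma sigma_algebra_almost_stone: "sigma_algebra ultrafilters almost_stone"
  unfolding sigma_algebra_iff2
proof (intro conjI ballI allI impI)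
  show "almost_stone \<subseteq> Pow ultrafilters" by (auto simp: almost_stone_def represents_def)
  show "{} \<in> almost_stone"
    using represents_stone[OF bot_closed] by (auto simp: almost_stone_def stone_bot)
  show "ultrafilters - a \<in> almost_stone" if "a \<in> almost_stone" for a
    using that represents_neg by (auto simp: almost_stone_def)
  show "(\<Union>i. A i) \<in> almost_stone" if "range A \<subseteq> almost_stone" for A :: "nat \<Rightarrow> _"
  proof -
    have "A i \<in> almost_stone" for i using that by auto
    then have "represents (\<Squnion> (\<lambda>i. represented (A i))) (\<Union>i. A i)"
      by (intro represents_Join represents_represented)
    then show ?thesis by (auto simp: almost_stone_def)
  qed
qed

end

section \<open>The accessibility relation\<close>

context sigma_modal_alg
begin

text \<open>The canonical relation of Jonsson and Tarski on ultrafilters.\<close>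

definition acc :: "('a set \<times> 'a set) set" where
  "acc = {(x, y). x \<in> ultrafilters \<and> y \<in> ultrafilters \<and> (\<forall>b\<in>y. \<diamond> b \<in> x)}"

lemma dia_join:
  assumes a: "a \<in> carrier B" and b: "b \<in> carrier B"
  shows "\<diamond> (a \<squnion> b) = \<diamond> a \<squnion> \<diamond> b"
proof -
  \<comment> \<open>A binary join is the join of a sequence with just the two given values.\<close>
  have J: "\<Squnion> (\<lambda>n. if n = 0 then p else q) = p \<squnion> q" if "p \<in> carrier B" "q \<in> carrier B" for p q
  proof (rule le_antisym)
    let ?u = "\<lambda>n :: nat. if n = 0 then p else q"
    have u: "?u n \<in> carrier B" for n using that by simp
    show "\<Squnion> ?u \<in> carrier B" "p \<squnion> q \<in> carrier B" using Join_closed[of ?u, OF u] join_closed that by auto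
    show "\<Squnion> ?u \<sqsubseteq> p \<squnion> q"
      using that by (intro Join_least u) (auto simp: join_closed le_join1 le_join2)
    show "p \<squnion> q \<sqsubseteq> \<Squnion> ?u"
      using Join_upper[of ?u 0, OF u] Join_upper[of ?u 1, OF u] that Join_closed[of ?u, OF u]
      by (intro join_least) auto
  qed
  have "\<diamond> (\<Squnion> (\<lambda>n. if n = 0 then a else b)) = \<Squnion> (\<lambda>n. \<diamond> (if n = 0 then a else b))"
    using a b by (intro dia_Join) auto
  also have "(\<lambda>n :: nat. \<diamond> (if n = 0 then a else b)) = (\<lambda>n. if n = 0 then \<diamond> a else \<diamond> b)" by auto
  finally show ?thesis using a b by (simp add: J dia_closed)
qed

lemma dia_mono:
  assumes "a \<in> carrier B" "b \<in> carrier B" "a \<sqsubseteq> b"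
  shows "\<diamond> a \<sqsubseteq> \<diamond> b"
proof -
  have "a \<squnion> b = b"
    using assms join_meet_absorb[of b a] join_comm[of a b] meet_comm[of a b] by (simp add: ba_le_def)
  then show ?thesis using dia_join[of a b] assms le_join1[of "\<diamond> a" "\<diamond> b"] dia_closed by simp
qed

text \<open>
  If \<open>\<diamond> b \<in> x\<close>, the elements \<open>c\<close> with \<open>\<diamond> c \<notin> x\<close> form an ideal that does not contain \<open>b\<close>. An
  ultrafilter that contains \<open>b\<close> and misses this ideal is a successor of \<open>x\<close>.
\<close>

lemma frame_dia_stone:
  assumes b: "b \<in> carrier B"
  shows "frame_dia ultrafilters acc (stone b) = stone (\<diamond> b)"
proof
  show "frame_dia ultrafilters acc (stone b) \<subseteq> stone (\<diamond> b)"
    by (auto simp: frame_dia_def acc_def stone_def)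
  show "stone (\<diamond> b) \<subseteq> frame_dia ultrafilters acc (stone b)"
  proof
    fix x assume x: "x \<in> stone (\<diamond> b)"
    let ?J = "{c \<in> carrier B. x \<notin> stone (\<diamond> c)}"
    have "ideal ?J"
      unfolding ideal_def
    proof (intro conjI ballI impI)
      show "\<bottom> \<in> ?J" by (simp add: bot_closed dia_bot stone_bot)
      show "a \<in> ?J" if "a \<in> carrier B" "c \<in> ?J" "a \<sqsubseteq> c" for a c
        using that stone_mono[OF _ _ dia_mono[of a c]] by (auto simp: dia_closed)
      show "a \<squnion> c \<in> ?J" if "a \<in> ?J" "c \<in> ?J" for a c
        using that by (auto simp: join_closed dia_join stone_join dia_closed)
    qed auto
    then obtain y where y: "y \<in> ultrafilters" "b \<in> y" "y \<inter> ?J = {}"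
      using ultrafilter_separation[of ?J b] b x by blast
    then have "\<forall>c\<in>y. \<diamond> c \<in> x" by (auto simp: ultrafilters_def stone_def)
    then show "x \<in> frame_dia ultrafilters acc (stone b)"
      using x y by (auto simp: frame_dia_def acc_def stone_def)
  qed
qed

end

context measurable_sigma_modal_alg
begin

text \<open>
  A point of \<open>\<diamond>\<^sub>R (\<Inter>n. stone (d n))\<close> sees one ultrafilter that contains all \<open>d n\<close>, so the point itself
  contains all \<open>\<diamond> (d n)\<close>. By measurability the sequence of the \<open>\<diamond> (d n)\<close> descends to \<open>\<bottom>\<close> if \<open>d\<close> does.
\<close>

lemma meagre_frame_dia:
  assumes "meagre N"
  shows "meagre (frame_dia ultrafilters acc N)"
proof -
  obtain d :: "nat \<Rightarrow> nat \<Rightarrow> 'a" where d: "\<And>k. descends_to_bot (d k)"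
    and N: "N \<subseteq> (\<Union>k. \<Inter>n. stone (d k n))"
    using assms unfolding meagre_def by auto
  have "descends_to_bot (\<lambda>n. \<diamond> (d k n))" for k
    using d[of k] dia_Meet_bot[of "d k"] by (auto simp: descends_to_bot_def dia_closed dia_mono)
  then have "meagre (\<Union>k. \<Inter>n. stone (\<diamond> (d k n)))"
    by (intro meagre_UN meagre_INT_stone)
  moreover have "frame_dia ultrafilters acc N \<subseteq> (\<Union>k. \<Inter>n. stone (\<diamond> (d k n)))"
  proof
    fix x assume "x \<in> frame_dia ultrafilters acc N"
    then obtain y where y: "x \<in> ultrafilters" "(x, y) \<in> acc" "y \<in> N"
      by (auto simp: frame_dia_def)
    from this(3) N have "y \<in> (\<Union>k. \<Inter>n. stone (d k n))" ..
    then obtain k where "y \<in> (\<Inter>n. stone (d k n))" ..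
    then have "x \<in> (\<Inter>n. stone (\<diamond> (d k n)))" using y by (auto simp: acc_def stone_def)
    then show "x \<in> (\<Union>k. \<Inter>n. stone (\<diamond> (d k n)))" by (rule UN_I[OF UNIV_I])
  qed
  ultimately show ?thesis by (rule meagre_subset)
qed

text \<open>
  Since \<open>\<diamond>\<^sub>R\<close> preserves unions, \<open>\<diamond>\<^sub>R u - \<diamond>\<^sub>R v \<subseteq> \<diamond>\<^sub>R (u - v)\<close> for all sets \<open>u\<close> and \<open>v\<close>. So the error made
  by replacing \<open>a\<close> with \<open>stone b\<close> is carried to a meagre set.
\<close>

lemma represents_dia:
  assumes "represents b a"
  shows "represents (\<diamond> b) (frame_dia ultrafilters acc a)"
proof (rule representsI)
  note r = representsD[OF assms]
  let ?D = "frame_dia ultrafilters acc"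
  show "\<diamond> b \<in> carrier B" using r by (simp add: dia_closed)
  show "?D a \<subseteq> ultrafilters" by (auto simp: frame_dia_def)
  show "meagre (?D (sym_diff a (stone b)))" by (intro meagre_frame_dia r)
  show "sym_diff (?D a) (stone (\<diamond> b)) \<subseteq> ?D (sym_diff a (stone b))"
    unfolding frame_dia_stone[OF r(1), symmetric] by (auto simp: frame_dia_def)
qed

lemma modal_sigma_field_almost_stone: "modal_sigma_field ultrafilters acc almost_stone"
  unfolding modal_sigma_field_def
  using sigma_algebra_almost_stone represents_dia by (auto simp: almost_stone_def)

lemma sigma_modal_hom_represented:
  "sigma_modal_hom (field_alg ultrafilters acc almost_stone) B represented"
proof -
  note r = represents_represented
  have bot: "represents \<bottom> {}" and top: "represents \<top> ultrafilters"
    using represents_stone[OF bot_closed] represents_stone[OF top_closed]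
    by (simp_all add: stone_bot stone_top)
  show ?thesis
    unfolding sigma_modal_hom_def field_alg_def modal_alg.simps partial_object.simps
    by (intro conjI ballI allI impI)
      ((rule representsD(1)[OF r], assumption) |
       (rule represented_eqI,
        (rule bot top represents_neg represents_meet represents_join represents_Meet
          represents_Join represents_dia r | assumption | erule spec)+))+
qed

lemma represented_surj: "represented ` almost_stone = carrier B"
proof
  show "represented ` almost_stone \<subseteq> carrier B"
    using represents_represented by (auto simp: represents_def)
  show "carrier B \<subseteq> represented ` almost_stone"
  proof
    fix b assume "b \<in> carrier B"
    then have r: "represents b (stone b)" by (rule represents_stone)
    then have "b = represented (stone b)" "stone b \<in> almost_stone"
      by (auto simp: represented_eqI[OF r] almost_stone_def)
    then show "b \<in> represented ` almost_stone" by (rule image_eqI)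
  qed
qed

end

section \<open>The representation theorem\<close>

theorem theorem8p5:
  fixes B :: "'a modal_alg"
  assumes "measurable_sigma_modal_alg B"
  shows "\<exists>(X :: 'a set set) (R :: ('a set \<times> 'a set) set) (F :: 'a set set set) (I :: 'a set set set).
           kripke_frame X R \<and> modal_sigma_field X R F \<and>
           modal_sigma_ideal (field_alg X R F) I \<and>
           sigma_modal_isomorphic B (quotient_alg (field_alg X R F) I)"
proof -
  interpret measurable_sigma_modal_alg B by fact
  let ?A = "field_alg ultrafilters acc almost_stone"
  have A: "sigma_modal_alg ?A"
    using modal_sigma_field_almost_stone by (rule sigma_modal_alg_field_alg)
  have B: "sigma_modal_alg B" ..
  note hom = sigma_modal_hom_represented
  have "represented ` carrier ?A = carrier B"
    using represented_surj by (simp add: field_alg_def)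
  then have "sigma_modal_isomorphic B (quotient_alg ?A (hom_kernel ?A B represented))"
    by (rule first_isomorphism_theorem[OF A B hom])
  moreover have "modal_sigma_ideal ?A (hom_kernel ?A B represented)"
    by (rule modal_sigma_ideal_hom_kernel[OF A B hom])
  moreover have "kripke_frame ultrafilters acc"
    by (auto simp: kripke_frame_def acc_def)
  ultimately show ?thesis
    using modal_sigma_field_almost_stone by blast
qed

end
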